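(* Let $n\ge1$ and $\alpha\in(0,1)$ be such that $\alpha(n+1)\in(1,\infty)\setminus\mathbb N$. Then, for any $s\in\left(\alpha,\frac{\lceil\alpha(n+1)\rceil}{n+1}\right)$, there exists $C_{n,\alpha}>0$ such that the function $F_{n,\alpha}:[0,1]\to\mathbb R$, $$F_{n,\alpha}(p):=\frac1\alpha\cdot\frac{1+\exp\big(C_{n,\alpha}(\alpha-s)\big)}{1+\exp\big(C_{n,\alpha}(p-s)\big)},$$ belongs to the set $\mathcal E_{n,\alpha}$. Additionally, $F_{n,\alpha}\ge F_{\mathrm{AoN}}$ pointwise on $[0,1]$, where $F_{\mathrm{AoN}}(p)=\frac1\alpha\mathbf 1_{\{p\le\alpha\}}$.
   Context: Let $P_n$ be the conformal p-variable $$P_n(y)=\frac{1+\sum_{i=1}^n\mathbf 1\{s_i\ge s_{n+1}(y)\}}{n+1},$$ where $s_1,\dots,s_n$ are the nonconformity scores of the calibration points and $s_{n+1}(y)$ is that of the test point with candidate response $y$; the calibration and test data are exchangeable and the scores have a continuous joint distribution (no ties), so that under the null hypothesis $\mathbb H_0:Y_{n+1}=y$ the variable $P_n$ is uniformly distributed on $\{\frac1{n+1},\frac2{n+1},\dots,1\}$. $\mathcal E_{n,\alpha}$ (the set of "P2E calibrators") denotes the set of all functions on $[0,1]$ of the form $p\mapsto\frac{f(p)}{\alpha f(\alpha)}$, where $f:[0,1]\to\mathbb R$ is positive, strictly decreasing, and satisfies $$\mathbb E_{\mathbb H_0}\!\left[\frac{f(P_n)}{\alpha f(\alpha)}\right]=1,\quad\text{i.e.}\quad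 \frac1{n+1}\sum_{k=1}^{n+1}f\!\left(\frac k{n+1}\right)=\alpha f(\alpha).$$ *)

theory Defs
  imports "HOL-Probability.Probability"
begin

text \<open>
  Scores are indexed by \<open>{1..n+1}\<close>; the last one is the score of the test point with its
  candidate response.
\<close>

definition conformal_p :: "nat \<Rightarrow> (nat \<Rightarrow> real) \<Rightarrow> real" where
  "conformal_p n s = (1 + real (card {i \<in> {1..n}. s i \<ge> s (n + 1)})) / real (n + 1)"

definition null_law :: "nat \<Rightarrow> real pmf" where
  "null_law n = pmf_of_set ((\<lambda>k. real k / real (n + 1)) ` {1..n+1})"

text \<open>
  Under the null hypothesis the \<open>n + 1\<close> scores are exchangeable. Of the continuity of their
  joint distribution only its consequence, the almost sure absence of ties, is needed for
  \<open>null_law n\<close> to be the law of the p-variable; see \<open>expectation_conformal_p\<close>.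
\<close>

locale conformal_null = prob_space M for M :: "'a measure" +
  fixes n :: nat and S :: "nat \<Rightarrow> 'a \<Rightarrow> real"
  assumes score_measurable: "\<And>i. i \<in> {1..n+1} \<Longrightarrow> S i \<in> borel_measurable M"
    and exchangeable: "\<And>\<pi>. \<pi> permutes {1..n+1} \<Longrightarrow>
      distr M (PiM {1..n+1} (\<lambda>_. borel)) (\<lambda>\<omega>. \<lambda>i\<in>{1..n+1}. S (\<pi> i) \<omega>) =
      distr M (PiM {1..n+1} (\<lambda>_. borel)) (\<lambda>\<omega>. \<lambda>i\<in>{1..n+1}. S i \<omega>)"
    and no_ties: "AE \<omega> in M. inj_on (\<lambda>i. S i \<omega>) {1..n+1}"

definition score_rank :: "nat \<Rightarrow> (nat \<Rightarrow> real) \<Rightarrow> nat \<Rightarrow> nat" where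
  "score_rank n s i = card {j \<in> {1..n+1}. s j \<ge> s i}"

lemma conformal_p_eq_rank: "conformal_p n s = real (score_rank n s (n+1)) / real (n+1)"
proof -
  have "{j \<in> {1..n+1}. s j \<ge> s (n+1)} = insert (n+1) {j \<in> {1..n}. s j \<ge> s (n+1)}"
    by (auto simp: le_Suc_eq)
  then show ?thesis
    by (simp add: conformal_p_def score_rank_def)
qed

lemma score_rank_in: "i \<in> {1..n+1} \<Longrightarrow> score_rank n s i \<in> {1..n+1}"
proof -
  assume i: "i \<in> {1..n+1}"
  have "card {j \<in> {1..n+1}. s j \<ge> s i} \<le> card {1..n+1}"
    by (rule card_mono) auto
  moreover have "card {j \<in> {1..n+1}. s j \<ge> s i} > 0"
    using i by (subst card_gt_0_iff) auto
  ultimately show ?thesis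
    by (simp add: score_rank_def)
qed

lemma bij_score_rank:
  assumes "inj_on s {1..n+1}"
  shows "bij_betw (score_rank n s) {1..n+1} {1..n+1}"
proof -
  have less: "score_rank n s j < score_rank n s i"
    if "i \<in> {1..n+1}" "j \<in> {1..n+1}" "s i < s j" for i j
    unfolding score_rank_def
  proof (rule psubset_card_mono)
    have "i \<in> {j \<in> {1..n+1}. s j \<ge> s i}" "i \<notin> {k \<in> {1..n+1}. s k \<ge> s j}"
      using that by auto
    moreover have "{k \<in> {1..n+1}. s k \<ge> s j} \<subseteq> {k \<in> {1..n+1}. s k \<ge> s i}"
      using that by auto
    ultimately show "{k \<in> {1..n+1}. s k \<ge> s j} \<subset> {k \<in> {1..n+1}. s k \<ge> s i}"
      by blast
  qed simp
  have inj: "inj_on (score_rank n s) {1..n+1}"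
  proof (rule inj_onI, rule ccontr)
    fix i j assume ij: "i \<in> {1..n+1}" "j \<in> {1..n+1}" "score_rank n s i = score_rank n s j" "i \<noteq> j"
    then have "s i \<noteq> s j"
      using assms by (meson inj_onD)
    then show False
      using less[of i j] less[of j i] ij by linarith
  qed
  moreover have "score_rank n s ` {1..n+1} \<subseteq> {1..n+1}"
    using score_rank_in by blast
  ultimately show ?thesis
    by (simp add: bij_betw_def endo_inj_surj)
qed

context conformal_null
begin

lemma rank_measurable:
  assumes "i \<in> {1..n+1}"
  shows "(\<lambda>x. score_rank n x i) \<in> measurable (PiM {1..n+1} (\<lambda>_. borel)) (count_space UNIV)"
proof -
  have comp: "\<And>j. j \<in> {1..n+1} \<Longrightarrow>
      (\<lambda>x. x j) \<in> borel_measurable (PiM {1..n+1} (\<lambda>_. borel :: real measure))"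
    by (rule measurable_component_singleton)
  have [measurable]: "Measurable.pred (PiM {1..n+1} (\<lambda>_. borel :: real measure)) (\<lambda>x. x i \<le> x j)"
    if "j \<in> {1..n+1}" for j
    unfolding pred_def by (rule borel_measurable_le[OF comp[OF assms] comp[OF that]])
  show ?thesis
    using assms unfolding score_rank_def by measurable
qed

lemma scores_measurable:
  assumes "\<pi> permutes {1..n+1}"
  shows "(\<lambda>\<omega>. \<lambda>i\<in>{1..n+1}. S (\<pi> i) \<omega>) \<in> measurable M (PiM {1..n+1} (\<lambda>_. borel))"
  using score_measurable permutes_in_image[OF assms]
  by (intro measurable_restrict) auto

lemma rank_event:
  assumes "i \<in> {1..n+1}"
  shows "{\<omega> \<in> space M. score_rank n (\<lambda>j. S j \<omega>) i = k} \<in> events"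
proof -
  have [measurable]: "\<And>i. i \<in> {1..n+1} \<Longrightarrow> S i \<in> borel_measurable M"
    by (rule score_measurable)
  show ?thesis
    using assms unfolding score_rank_def by measurable
qed

lemma prob_rank_eq:
  assumes i: "i \<in> {1..n+1}"
  shows "prob {\<omega> \<in> space M. score_rank n (\<lambda>j. S j \<omega>) i = k} =
         prob {\<omega> \<in> space M. score_rank n (\<lambda>j. S j \<omega>) (n+1) = k}"
proof -
  let ?P = "PiM {1..n+1} (\<lambda>_. borel :: real measure)"
  define \<pi> where "\<pi> = Transposition.transpose i (n+1)"
  have \<pi>: "\<pi> permutes {1..n+1}"
    unfolding \<pi>_def using i by (intro permutes_swap_id) auto
  let ?A = "{x \<in> space ?P. score_rank n x (n+1) = k}"
  have A: "?A \<in> sets ?P"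
    using measurable_sets[OF rank_measurable[of "n+1"], of "{k}"]
    by (simp only: vimage_def Int_def) (simp add: conj_commute)
  have r: "score_rank n (\<lambda>j\<in>{1..n+1}. S (\<sigma> j) \<omega>) (n+1) = score_rank n (\<lambda>j. S j \<omega>) (\<sigma> (n+1))"
    if \<sigma>: "\<sigma> permutes {1..n+1}" for \<sigma> \<omega>
  proof -
    have "{j \<in> {1..n+1}. S j \<omega> \<ge> S (\<sigma> (n+1)) \<omega>} =
          \<sigma> ` {j \<in> {1..n+1}. S (\<sigma> j) \<omega> \<ge> S (\<sigma> (n+1)) \<omega>}" (is "?L = \<sigma> ` ?R")
    proof
      show "?L \<subseteq> \<sigma> ` ?R"
      proof
        fix x assume x: "x \<in> ?L"
        then have "x \<in> \<sigma> ` {1..n+1}"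
          using permutes_image[OF \<sigma>] by simp
        then obtain y where "y \<in> {1..n+1}" "x = \<sigma> y" by blast
        then show "x \<in> \<sigma> ` ?R" using x by blast
      qed
      show "\<sigma> ` ?R \<subseteq> ?L"
        using permutes_in_image[OF \<sigma>] by auto
    qed
    moreover have "inj_on \<sigma> ?R"
      using permutes_inj[OF \<sigma>] by (rule inj_on_subset) simp
    ultimately have "card ?L = card ?R"
      by (simp add: card_image)
    moreover have "{j \<in> {1..n+1}. (\<lambda>j\<in>{1..n+1}. S (\<sigma> j) \<omega>) j \<ge> (\<lambda>j\<in>{1..n+1}. S (\<sigma> j) \<omega>) (n+1)} = ?R"
      by auto
    ultimately show ?thesis
      unfolding score_rank_def by simp
  qed
  have m: "measure (distr M ?P (\<lambda>\<omega>. \<lambda>j\<in>{1..n+1}. S (\<sigma> j) \<omega>)) ?A =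
           prob {\<omega> \<in> space M. score_rank n (\<lambda>j. S j \<omega>) (\<sigma> (n+1)) = k}"
    if \<sigma>: "\<sigma> permutes {1..n+1}" for \<sigma>
  proof -
    have "(\<lambda>\<omega>. \<lambda>j\<in>{1..n+1}. S (\<sigma> j) \<omega>) -` ?A \<inter> space M =
          {\<omega> \<in> space M. score_rank n (\<lambda>j. S j \<omega>) (\<sigma> (n+1)) = k}"
      using measurable_space[OF scores_measurable[OF \<sigma>]] r[OF \<sigma>] by auto
    then show ?thesis
      using measure_distr[OF scores_measurable[OF \<sigma>] A] by simp
  qed
  have i_eq: "\<pi> (n+1) = i"
    by (simp add: \<pi>_def)
  have "prob {\<omega> \<in> space M. score_rank n (\<lambda>j. S j \<omega>) (\<pi> (n+1)) = k} =
        measure (distr M ?P (\<lambda>\<omega>. \<lambda>j\<in>{1..n+1}. S (\<pi> j) \<omega>)) ?A"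
    by (rule m[OF \<pi>, symmetric])
  also have "\<dots> = measure (distr M ?P (\<lambda>\<omega>. \<lambda>j\<in>{1..n+1}. S j \<omega>)) ?A"
    by (rule arg_cong[OF exchangeable[OF \<pi>]])
  also have "\<dots> = prob {\<omega> \<in> space M. score_rank n (\<lambda>j. S j \<omega>) (n+1) = k}"
    by (rule m[OF permutes_id, unfolded id_apply])
  finally show ?thesis
    unfolding i_eq .
qed

lemma prob_rank:
  assumes k: "k \<in> {1..n+1}"
  shows "prob {\<omega> \<in> space M. score_rank n (\<lambda>j. S j \<omega>) (n+1) = k} = 1 / real (n+1)"
proof -
  let ?E = "\<lambda>i. {\<omega> \<in> space M. score_rank n (\<lambda>j. S j \<omega>) i = k}"
  have "AE \<omega> in M. (\<Sum>i\<in>{1..n+1}. indicator (?E i) \<omega>) = (1::real)"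
    using no_ties AE_space
  proof eventually_elim
    case (elim \<omega>)
    let ?r = "score_rank n (\<lambda>j. S j \<omega>)"
    have bij: "bij_betw ?r {1..n+1} {1..n+1}"
      by (rule bij_score_rank) (rule elim)
    have "(\<Sum>i\<in>{1..n+1}. indicator (?E i) \<omega>) = (\<Sum>i\<in>{1..n+1}. indicator {k} (?r i) :: real)"
      using elim by (intro sum.cong) (auto simp: indicator_def)
    also have "\<dots> = (\<Sum>j\<in>{1..n+1}. indicator {k} j)"
      by (rule sum.reindex_bij_betw[OF bij])
    also have "\<dots> = 1"
      using k by (simp add: indicator_def)
    finally show ?case .
  qed
  moreover have "(\<lambda>\<omega>. \<Sum>i\<in>{1..n+1}. indicator (?E i) \<omega> :: real) \<in> borel_measurable M"
    by (intro borel_measurable_sum borel_measurable_indicator rank_event)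
  ultimately have "expectation (\<lambda>\<omega>. \<Sum>i\<in>{1..n+1}. indicator (?E i) \<omega> :: real) = expectation (\<lambda>_. 1)"
    by (intro integral_cong_AE borel_measurable_const)
  then have "1 = expectation (\<lambda>\<omega>. \<Sum>i\<in>{1..n+1}. indicator (?E i) \<omega> :: real)"
    by (simp add: prob_space)
  also have "\<dots> = (\<Sum>i\<in>{1..n+1}. prob (?E i))"
    using rank_event
    by (subst Bochner_Integration.integral_sum) (auto simp: integrable_indicator_iff emeasure_eq_measure)
  also have "\<dots> = (\<Sum>i\<in>{1..n+1}. prob (?E (n+1)))"
    by (rule sum.cong[OF refl prob_rank_eq])
  finally show ?thesis
    by (simp add: field_simps)
qed

theorem expectation_conformal_p:
  fixes g :: "real \<Rightarrow> real"
  shows "expectation (\<lambda>\<omega>. g (conformal_p n (\<lambda>i. S i \<omega>))) = measure_pmf.expectation (null_law n) g"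
proof -
  let ?E = "\<lambda>k. {\<omega> \<in> space M. score_rank n (\<lambda>j. S j \<omega>) (n+1) = k}"
  let ?q = "\<lambda>k. real k / real (n+1)"
  have "expectation (\<lambda>\<omega>. g (conformal_p n (\<lambda>i. S i \<omega>))) =
        expectation (\<lambda>\<omega>. \<Sum>k\<in>{1..n+1}. indicator (?E k) \<omega> * g (?q k))"
  proof (rule Bochner_Integration.integral_cong[OF refl])
    fix \<omega> assume \<omega>: "\<omega> \<in> space M"
    let ?r = "score_rank n (\<lambda>j. S j \<omega>) (n+1)"
    have "(\<Sum>k\<in>{1..n+1}. indicator (?E k) \<omega> * g (?q k)) =
          (\<Sum>k\<in>{1..n+1}. if k = ?r then g (?q k) else 0)"
      using \<omega> by (intro sum.cong) auto
    also have "\<dots> = g (?q ?r)"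
      using score_rank_in[of "n+1" n "\<lambda>j. S j \<omega>"] by (subst sum.delta) auto
    finally show "g (conformal_p n (\<lambda>i. S i \<omega>)) = (\<Sum>k\<in>{1..n+1}. indicator (?E k) \<omega> * g (?q k))"
      by (simp add: conformal_p_eq_rank)
  qed
  also have "\<dots> = (\<Sum>k\<in>{1..n+1}. prob (?E k) * g (?q k))"
    using rank_event[of "n+1"]
    by (subst Bochner_Integration.integral_sum) (auto simp: integrable_indicator_iff emeasure_eq_measure)
  also have "\<dots> = (\<Sum>k\<in>{1..n+1}. g (?q k) / real (n+1))"
    by (intro sum.cong refl) (simp only: prob_rank, simp)
  also have "\<dots> = (\<Sum>k\<in>{1..n+1}. g (?q k)) / real (n+1)"
    by (simp only: sum_divide_distrib)
  also have "\<dots> = measure_pmf.expectation (null_law n) g"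
  proof -
    have inj: "inj_on ?q {1..n+1}"
      by (rule inj_onI) (simp add: divide_simps split: if_splits)
    have "measure_pmf.expectation (null_law n) g = sum g (?q ` {1..n+1}) / real (card (?q ` {1..n+1}))"
      unfolding null_law_def by (rule integral_pmf_of_set) auto
    then show ?thesis
      using inj by (simp only: card_image sum.reindex) simp
  qed
  finally show ?thesis .
qed

end

text \<open>
  Functions on \<open>[0,1]\<close> are represented by total functions whose values outside \<open>[0,1]\<close> are
  unconstrained.
\<close>

definition P2E_calibrators :: "nat \<Rightarrow> real \<Rightarrow> (real \<Rightarrow> real) set" where
  "P2E_calibrators n \<alpha> = {g. \<exists>f :: real \<Rightarrow> real.
      (\<forall>p\<in>{0..1}. f p > 0) \<and>
      strict_antimono_on {0..1} f \<and>
      measure_pmf.expectation (null_law n) (\<lambda>p. f p / (\<alpha> * f \<alpha>)) = 1 \<and>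
      (\<forall>p\<in>{0..1}. g p = f p / (\<alpha> * f \<alpha>))}"

definition F_AoN :: "real \<Rightarrow> real \<Rightarrow> real" where
  "F_AoN \<alpha> p = 1 / \<alpha> * indicator {p. p \<le> \<alpha>} p"

definition F_logistic :: "real \<Rightarrow> real \<Rightarrow> real \<Rightarrow> real \<Rightarrow> real" where
  "F_logistic \<alpha> s C p = 1 / \<alpha> * ((1 + exp (C * (\<alpha> - s))) / (1 + exp (C * (p - s))))"

end

theory Submission
  imports Defs
begin

text \<open>
  The null expectation of \<open>F_logistic \<alpha> s C\<close> is a continuous function of \<open>C\<close>. At \<open>C = 0\<close> it is
  \<open>1 / \<alpha> > 1\<close>. Since \<open>\<alpha> < s\<close> and no grid point \<open>k / (n + 1)\<close> lies in \<open>{\<alpha>..s}\<close>, it tends to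
  \<open>\<lfloor>\<alpha> (n + 1)\<rfloor> / (\<alpha> (n + 1)) < 1\<close> as \<open>C\<close> tends to infinity. The intermediate value theorem gives
  the required \<open>C\<close>.
\<close>

text \<open>The grid points are distinct, so the uniform law on their set averages over the indices
  \<open>k\<close>.\<close>

lemma expectation_null_law:
  fixes g :: "real \<Rightarrow> real"
  shows "measure_pmf.expectation (null_law n) g =
    (\<Sum>k\<in>{1..n+1}. g (real k / real (n+1))) / real (n+1)"
proof -
  let ?q = "\<lambda>k. real k / real (n+1)"
  have inj: "inj_on ?q {1..n+1}"
    by (rule inj_onI) (simp add: divide_simps split: if_splits)
  have "measure_pmf.expectation (null_law n) g = sum g (?q ` {1..n+1}) / real (card (?q ` {1..n+1}))"
    unfolding null_law_def by (rule integral_pmf_of_set) auto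
  then show ?thesis
    using inj by (simp only: card_image sum.reindex) simp
qed

lemma one_plus_exp_neq_0 [simp]: "1 + exp (x::real) \<noteq> 0"
  using exp_gt_zero[of x] by linarith

text \<open>The witness is the decreasing logistic function \<open>f\<close>; the numerator of
  \<open>F_logistic\<close> is \<open>1 / f \<alpha>\<close>. Positivity and monotonicity hold for
  every \<open>C > 0\<close>, which leaves the unit mean as the only condition on
  \<open>C\<close>.\<close>

lemma F_logistic_in_P2E_calibrators:
  assumes "C > 0"
    and "measure_pmf.expectation (null_law n) (F_logistic \<alpha> s C) = 1"
  shows "F_logistic \<alpha> s C \<in> P2E_calibrators n \<alpha>"
proof -
  define f where "f p = 1 / (1 + exp (C * (p - s)))" for p
  have F: "F_logistic \<alpha> s C = (\<lambda>p. f p / (\<alpha> * f \<alpha>))"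
    by (auto simp: F_logistic_def f_def)
  have "f p > 0" for p
    by (simp add: f_def add_pos_pos)
  moreover have "strict_antimono_on {0..1} f"
    using assms(1) by (intro monotone_onI) (auto simp: f_def add_pos_pos intro!: divide_strict_left_mono)
  ultimately show ?thesis
    using assms(2) unfolding P2E_calibrators_def F by blast
qed

text \<open>Up to \<open>\<alpha>\<close> the denominator is at most its value at
  \<open>\<alpha>\<close>, which is the numerator; beyond \<open>\<alpha>\<close> the left side
  vanishes.\<close>

lemma F_AoN_le_F_logistic:
  assumes "0 < \<alpha>" and "C \<ge> 0"
  shows "F_AoN \<alpha> p \<le> F_logistic \<alpha> s C p"
proof (cases "p \<le> \<alpha>")
  case True
  then have "C * (p - s) \<le> C * (\<alpha> - s)"
    using assms by (simp add: mult_left_mono)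
  then have "1 \<le> (1 + exp (C * (\<alpha> - s))) / (1 + exp (C * (p - s)))"
    by (simp add: le_divide_eq add_pos_pos)
  then have "1 / \<alpha> * 1 \<le> 1 / \<alpha> * ((1 + exp (C * (\<alpha> - s))) / (1 + exp (C * (p - s))))"
    using assms by (intro mult_left_mono) auto
  then show ?thesis
    using True by (simp add: F_AoN_def F_logistic_def)
next
  case False
  then show ?thesis
    using assms by (simp add: F_AoN_def F_logistic_def add_nonneg_nonneg)
qed

lemma tendsto_exp_mult_neg:
  assumes "(a::real) < 0"
  shows "((\<lambda>C. exp (C * a)) \<longlongrightarrow> 0) at_top"
proof -
  have "LIM C at_top. a * C :> at_bot"
    using assms by (intro filterlim_tendsto_neg_mult_at_bot[OF tendsto_const] filterlim_ident)
  then show ?thesis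
    using filterlim_compose[OF exp_at_bot] by (simp add: mult.commute)
qed

text \<open>The numerator tends to 1 because \<open>\<alpha> < s\<close>, and the denominator tends
  to 1 or to infinity according to the side of \<open>s\<close>. At \<open>p = s\<close> it would be
  constantly 2, hence the exclusion.\<close>

lemma F_logistic_tendsto:
  assumes "\<alpha> < s" and "p \<noteq> s"
  shows "((\<lambda>C. F_logistic \<alpha> s C p) \<longlongrightarrow> (if p < s then 1 / \<alpha> else 0)) at_top"
proof -
  have num: "((\<lambda>C. 1 + exp (C * (\<alpha> - s))) \<longlongrightarrow> 1 + 0) at_top"
    using assms by (intro tendsto_intros tendsto_exp_mult_neg) auto
  show ?thesis
  proof (cases "p < s")
    case True
    then have "((\<lambda>C. 1 + exp (C * (p - s))) \<longlongrightarrow> 1 + 0) at_top"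
      by (intro tendsto_intros tendsto_exp_mult_neg) auto
    from tendsto_mult_left[OF tendsto_divide[OF num this], of "1 / \<alpha>"] True
    show ?thesis by (simp add: F_logistic_def)
  next
    case False
    then have "p - s > 0" using assms by simp
    then have "LIM C at_top. 1 + exp (C * (p - s)) :> at_top"
      by (intro filterlim_tendsto_add_at_top[OF tendsto_const] filterlim_compose[OF exp_at_top]
          filterlim_at_top_mult_tendsto_pos[OF tendsto_const] filterlim_ident)
    from tendsto_mult_left[OF tendsto_divide_0[OF num filterlim_at_top_imp_at_infinity[OF this]],
        of "1 / \<alpha>"] False
    show ?thesis by (simp add: F_logistic_def)
  qed
qed

theorem theorem2p6:
  fixes n :: nat and \<alpha> s :: real
  assumes "n \<ge> 1"
    and "0 < \<alpha>" and "\<alpha> < 1"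
    and "\<alpha> * real (n + 1) > 1" and "\<alpha> * real (n + 1) \<notin> \<nat>"
    and "s \<in> {\<alpha> <..< real_of_int \<lceil>\<alpha> * real (n + 1)\<rceil> / real (n + 1)}"
  shows "\<exists>C>0. F_logistic \<alpha> s C \<in> P2E_calibrators n \<alpha> \<and>
           (\<forall>p\<in>{0..1}. F_logistic \<alpha> s C p \<ge> F_AoN \<alpha> p)"
proof -
  define N where "N = real (n + 1)"
  have N: "N > 0" by (simp add: N_def)
  define m where "m = nat \<lfloor>\<alpha> * N\<rfloor>"
  define h where "h C = measure_pmf.expectation (null_law n) (F_logistic \<alpha> s C)" for C
  have h_eq: "h C = (\<Sum>k\<in>{1..n+1}. F_logistic \<alpha> s C (real k / N)) / N" for C
    by (simp only: h_def expectation_null_law N_def)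
  have m: "real m = of_int \<lfloor>\<alpha> * N\<rfloor>"
    using assms(2) N by (simp add: m_def)
  \<comment> \<open>Non-integrality makes the floor inequality strict; this strictness puts the
    limit of \<open>h\<close> below 1.\<close>
  have "real m \<noteq> \<alpha> * N"
    using assms(5) unfolding N_def by (metis of_nat_in_Nats)
  then have m_less: "real m < \<alpha> * N"
    using m of_int_floor_le[of "\<alpha> * N"] by linarith
  have s: "\<alpha> < s" "s < of_int \<lceil>\<alpha> * N\<rceil> / N"
    using assms(6) by (auto simp: N_def)
  have "\<lceil>\<alpha> * N\<rceil> \<le> \<lfloor>\<alpha> * N\<rfloor> + 1" by linarith
  then have upper: "s * N < real m + 1"
    using s(2) N m by (simp add: field_simps)
  have lower: "real m < s * N"
    using m_less s(1) N by (meson less_trans mult_strict_right_mono)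
  \<comment> \<open>By \<open>lower\<close> and \<open>upper\<close>, \<open>s\<close> lies strictly
    between the consecutive grid values \<open>m / N\<close> and \<open>(m + 1) / N\<close>.\<close>
  have grid: "real k / N < s \<longleftrightarrow> k \<le> m" "real k / N \<noteq> s" for k
  proof -
    have "real k / N < s \<longleftrightarrow> real k < s * N" "real k / N = s \<longleftrightarrow> real k = s * N"
      using N by (auto simp: field_simps)
    moreover have "real k < s * N \<longleftrightarrow> k \<le> m" "real k \<noteq> s * N"
    proof -
      consider "real k \<le> real m" | "real m + 1 \<le> real k"
        by (cases "k \<le> m") auto
      then show "real k < s * N \<longleftrightarrow> k \<le> m" "real k \<noteq> s * N"
        by (cases; use upper lower in auto)+
    qed
    ultimately show "real k / N < s \<longleftrightarrow> k \<le> m" "real k / N \<noteq> s"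
      by auto
  qed

  have "(h \<longlongrightarrow> (\<Sum>k\<in>{1..n+1}. if k \<le> m then 1 / \<alpha> else 0) / N) at_top"
    unfolding h_eq[abs_def] using N F_logistic_tendsto[OF s(1) grid(2)] unfolding grid(1)
    by (intro tendsto_divide tendsto_sum tendsto_const) auto
  moreover have "(\<Sum>k\<in>{1..n+1}. if k \<le> m then 1 / \<alpha> else 0) / N < 1"
  proof -
    \<comment> \<open>An upper bound on the number of grid points below \<open>s\<close> suffices
      here.\<close>
    have "card ({1..n+1} \<inter> {k. k \<le> m}) \<le> card {1..m}"
      by (intro card_mono) auto
    then have "real (card ({1..n+1} \<inter> {k. k \<le> m})) < \<alpha> * N"
      using m_less by simp
    moreover have "(\<Sum>k\<in>{1..n+1}. if k \<le> m then 1 / \<alpha> else 0) =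
        real (card ({1..n+1} \<inter> {k. k \<le> m})) / \<alpha>"
      by (subst sum.If_cases) simp_all
    ultimately show ?thesis
      using N assms(2) by (simp only: divide_less_eq) (simp add: mult.commute)
  qed
  ultimately have "\<forall>\<^sub>F C in at_top. h C < 1"
    by (rule order_tendstoD)
  then obtain B where B: "h B < 1" "B > 0"
    using eventually_happens[OF eventually_conj[OF _ eventually_gt_at_top[of 0]]] by force
  \<comment> \<open>At \<open>C = 0\<close> both exponentials are 1, so each of the \<open>N\<close>
    summands is \<open>1 / \<alpha>\<close>.\<close>
  have "h 0 = (N * (1 / \<alpha>)) / N"
    by (simp add: h_eq F_logistic_def N_def)
  then have "h 0 = 1 / \<alpha>"
    using N by simp
  then have h0: "h 0 > 1"
    using assms(2,3) by simp
  have "continuous_on {0..B} h"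
    unfolding h_eq[abs_def] F_logistic_def by (intro continuous_intros) (use N in auto)
  then obtain C where C: "0 \<le> C" "h C = 1"
    using IVT2'[of h B 1 0] B h0 by auto
  \<comment> \<open>The intermediate value theorem on \<open>{0..B}\<close> only gives
    \<open>C \<ge> 0\<close>; the endpoint 0 is excluded by \<open>h 0 > 1\<close>.\<close>
  then have "C > 0"
    using h0 by (cases "C = 0") auto
  with C assms(2) show ?thesis
    by (intro exI[of _ C] conjI ballI F_logistic_in_P2E_calibrators F_AoN_le_F_logistic)
       (auto simp: h_def)
qed

end
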